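(* Let $F$ be a field and let $A$ be a $q\times q$ matrix of index $t_{0}$ with coefficients in $F$ whose characteristic polynomial splits over $F$. Let $\mathbf{A}=(A^{k})_{k\geq 0}$ be the sequence of powers of $A$ (with $A^{0}=I$). Then the complete inverse of the sequence $\mathbf{A}$ is $\mathbf{A}_{c}=\widetilde{\theta}_{1}(\mathbf{A})$.
   Context: Index: the index of a square matrix $A$ is the smallest integer $t\ge 0$ with $\operatorname{rank}(A^{t})=\operatorname{rank}(A^{t+1})$. Complete inverse: for an element $a$ of an associative ring $R$, the complete inverse of $a$ is the unique element $x\in R$, if it exists, such that $axa-xax=a-x$, $ax=xa$, and $a^{n}xa=a^{n}$ for some positive integer $n$. Here it is taken in the ring of all sequences $(U_{k})_{k\ge 0}$ of $q\times q$ matrices over $F$ with termwise addition and termwise multiplication; this ring is identified with the ring $\mathbf{M}_q(\mathcal{C}_F)$ of $q\times q$ matrices over $\mathcal{C}_F$, where $\mathcal{C}_F$ is the $F$-algebra of all sequences $(s_k)_{k\ge0}$ over $F$ with termwise operations. Sequences: for $\lambda\in F\setminus\{0\}$ let $\boldsymbol{\lambda}=(\lambda^{k})_{k\ge 0}\in\mathcal{C}_F$; let $F_{\mathcal{S}^{*}}$ be the $F$-span of all such $\boldsymbol{\lambda}$ (they form a basis of it, and it is a subalgebra of $\mathcal{C}_F$). For $i\in\mathbb{N}$ ($i\ge 0$) let $\mathbf{0}_{i}\in\mathcal{C}_F$ be the sequence with $\mathbf{0}_{i}(k)=\delta_{ik}$. Let $\theta:F_{\mathcal{S}^{*}}\to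 F_{\mathcal{S}^{*}}$ be the $F$-algebra automorphism with $\theta(\boldsymbol{\lambda})=\boldsymbol{\lambda}^{-1}=(\lambda^{-k})_{k\ge 0}$, and let $\widetilde{\theta}:\mathbf{M}_q(F_{\mathcal{S}^{*}})\to\mathbf{M}_q(F_{\mathcal{S}^{*}})$ be $\theta$ applied entrywise. For $j\ge 0$ let $\Lambda_{j}=\bigl(\binom{k}{j}\bigr)_{k\ge 0}$ (binomial coefficients viewed in $F$), and let $\widetilde{\Lambda_{j}}=\bigl(\binom{-k}{j}\bigr)_{k\ge 0}$ be the sequence obtained by plugging in $-k$ for $k$, where $\binom{-k}{j}=(-1)^{j}\binom{k+j-1}{j}$ for $j\geq 1$ and $\binom{-k}{0}=1$. $\mathcal{P}$-canonical form: a sequence $\mathbf{U}$ of $q\times q$ matrices over $F$ has a $\mathcal{P}$-canonical form if it can be written as $$\mathbf{U}=\mathcal{V}_{0}\mathbf{0}_{0}+\cdots+\mathcal{V}_{n}\mathbf{0}_{n}+\mathcal{W}_{0}\Lambda_{0}+\cdots+\mathcal{W}_{m}\Lambda_{m}$$ with $\mathcal{V}_{i}\in\mathbf{M}_q(F)$ and $\mathcal{W}_{j}\in\mathbf{M}_q(F_{\mathcal{S}^{*}})$ for some $n,m\ge0$; such an expression is unique up to zero terms. When the characteristic polynomial of $A$ splits over $F$, the sequence $\mathbf{A}=(A^{k})_{k\ge0}$ has a $\mathcal{P}$-canonical form. For $\mathbf{U}$ with $\mathcal{P}$-canonical form $\mathbf{U}=\mathcal{V}_{0}\mathbf{0}_{0}+\cdots+\mathcal{V}_{n}\mathbf{0}_{n}+\mathcal{W}_{0}\Lambda_{0}+\cdots+\mathcal{W}_{m}\Lambda_{m}$,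 where $\mathcal{V}_{i}\in\mathbf{M}_q(F)$ and $\mathcal{W}_{j}\in\mathbf{M}_q(F_{\mathcal{S}^{*}})$, define $$\widetilde{\theta}_{1}(\mathbf{U})=\mathcal{V}_{0}\mathbf{0}_{0}+\cdots+\mathcal{V}_{n}\mathbf{0}_{n}+\widetilde{\theta}(\mathcal{W}_{0})\widetilde{\Lambda_{0}}+\cdots+\widetilde{\theta}(\mathcal{W}_{m})\widetilde{\Lambda_{m}}.$$ *)

theory Defs
  imports
    "Jordan_Normal_Form.Char_Poly"
    "Jordan_Normal_Form.DL_Rank"
    "HOL-Library.Function_Algebras"
begin

definition mat_index :: "nat \<Rightarrow> 'a::field mat \<Rightarrow> nat" where
  "mat_index q A =
     (LEAST t. vec_space.rank q (A ^\<^sub>m t) = vec_space.rank q (A ^\<^sub>m (Suc t)))"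

definition complete_inverse_eqs :: "('r, 'm) ring_scheme \<Rightarrow> 'r \<Rightarrow> 'r \<Rightarrow> bool" where
  "complete_inverse_eqs R a x \<longleftrightarrow>
     x \<in> carrier R \<and>
     a \<otimes>\<^bsub>R\<^esub> x \<otimes>\<^bsub>R\<^esub> a \<ominus>\<^bsub>R\<^esub> x \<otimes>\<^bsub>R\<^esub> a \<otimes>\<^bsub>R\<^esub> x = a \<ominus>\<^bsub>R\<^esub> x \<and>
     a \<otimes>\<^bsub>R\<^esub> x = x \<otimes>\<^bsub>R\<^esub> a \<and>
     (\<exists>n::nat. n > 0 \<and> a [^]\<^bsub>R\<^esub> n \<otimes>\<^bsub>R\<^esub> x \<otimes>\<^bsub>R\<^esub> a = a [^]\<^bsub>R\<^esub> n)"

definition is_complete_inverse :: "('r, 'm) ring_scheme \<Rightarrow> 'r \<Rightarrow> 'r \<Rightarrow> bool" where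
  "is_complete_inverse R a x \<longleftrightarrow>
     complete_inverse_eqs R a x \<and> (\<forall>y. complete_inverse_eqs R a y \<longrightarrow> y = x)"

definition mat_seq_ring :: "nat \<Rightarrow> (nat \<Rightarrow> 'a::field mat) ring" where
  "mat_seq_ring q =
     \<lparr>carrier = {U. \<forall>k. U k \<in> carrier_mat q q},
      mult = (\<lambda>U V k. U k * V k),
      one = (\<lambda>k. 1\<^sub>m q),
      zero = (\<lambda>k. 0\<^sub>m q q),
      add = (\<lambda>U V k. U k + V k)\<rparr>"

text \<open>
  The algebra of all scalar sequences is the type \<^typ>\<open>nat \<Rightarrow> 'a\<close> with the pointwise
  operations of \<^theory>\<open>HOL-Library.Function_Algebras\<close>; only the scalar action is missing there.
\<close>

definition seq_scale :: "'a::field \<Rightarrow> (nat \<Rightarrow> 'a) \<Rightarrow> (nat \<Rightarrow> 'a)" where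
  "seq_scale c s = (\<lambda>k. c * s k)"

global_interpretation seq_space: vector_space seq_scale
  by unfold_locales (auto simp: seq_scale_def fun_eq_iff algebra_simps)

definition geom_seq :: "'a::field \<Rightarrow> nat \<Rightarrow> 'a" where
  "geom_seq l = (\<lambda>k. l ^ k)"

definition geom_span :: "(nat \<Rightarrow> 'a::field) set" where
  "geom_span = seq_space.span (geom_seq ` (- {0}))"

definition delta_seq :: "nat \<Rightarrow> nat \<Rightarrow> 'a::field" where
  "delta_seq i = (\<lambda>k. if k = i then 1 else 0)"

definition Lambda_seq :: "nat \<Rightarrow> nat \<Rightarrow> 'a::field" where
  "Lambda_seq j = (\<lambda>k. of_nat (k choose j))"

definition Lambda_neg_seq :: "nat \<Rightarrow> nat \<Rightarrow> 'a::field" where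
  "Lambda_neg_seq j = (\<lambda>k. if j = 0 then 1 else (- 1) ^ j * of_nat ((k + j - 1) choose j))"

definition is_theta :: "((nat \<Rightarrow> 'a::field) \<Rightarrow> (nat \<Rightarrow> 'a)) \<Rightarrow> bool" where
  "is_theta f \<longleftrightarrow>
     bij_betw f geom_span geom_span \<and>
     (\<forall>s\<in>geom_span. \<forall>t\<in>geom_span. f (s + t) = f s + f t) \<and>
     (\<forall>s\<in>geom_span. \<forall>t\<in>geom_span. f (s * t) = f s * f t) \<and>
     (\<forall>c. \<forall>s\<in>geom_span. f (seq_scale c s) = seq_scale c (f s)) \<and>
     f 1 = 1 \<and>
     (\<forall>l. l \<noteq> 0 \<longrightarrow> f (geom_seq l) = geom_seq (inverse l))"

text \<open>Extensionality outside the subalgebra makes the automorphism unique as a total function.\<close>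

definition theta :: "(nat \<Rightarrow> 'a::field) \<Rightarrow> (nat \<Rightarrow> 'a)" where
  "theta = (THE f. is_theta f \<and> f \<in> extensional geom_span)"

text \<open>
  Matrices over the algebra of sequences are elements of \<^typ>\<open>(nat \<Rightarrow> 'a) mat\<close>. The following is
  the sequence of matrices identified with
  \<open>V 0 0\<^sub>0 + \<dots> + V n 0\<^sub>n + W 0 L\<^sub>0 + \<dots> + W m L\<^sub>m\<close>, the family \<open>L\<close> being
  \<^const>\<open>Lambda_seq\<close> or \<^const>\<open>Lambda_neg_seq\<close>.
\<close>

definition P_sum ::
  "nat \<Rightarrow> (nat \<Rightarrow> nat \<Rightarrow> 'a::field) \<Rightarrow> nat \<Rightarrow> (nat \<Rightarrow> 'a mat) \<Rightarrow> nat \<Rightarrow> (nat \<Rightarrow> (nat \<Rightarrow> 'a) mat)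
    \<Rightarrow> nat \<Rightarrow> 'a mat" where
  "P_sum q L n V m W = (\<lambda>k. mat q q (\<lambda>(r, c).
     (\<Sum>i\<le>n. V i $$ (r, c) * delta_seq i k) + (\<Sum>j\<le>m. (W j $$ (r, c)) k * L j k)))"

definition is_P_canonical_form ::
  "nat \<Rightarrow> (nat \<Rightarrow> 'a::field mat) \<Rightarrow> nat \<Rightarrow> (nat \<Rightarrow> 'a mat) \<Rightarrow> nat \<Rightarrow> (nat \<Rightarrow> (nat \<Rightarrow> 'a) mat)
    \<Rightarrow> bool" where
  "is_P_canonical_form q U n V m W \<longleftrightarrow>
     (\<forall>i\<le>n. V i \<in> carrier_mat q q) \<and>
     (\<forall>j\<le>m. W j \<in> carrier_mat q q \<and> elements_mat (W j) \<subseteq> geom_span) \<and>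
     U = P_sum q Lambda_seq n V m W"

text \<open>
  The description below determines a value because the canonical form of \<open>U\<close> is unique up to zero
  terms; it is meaningful only for sequences \<open>U\<close> that have a canonical form.
\<close>

definition theta1 :: "nat \<Rightarrow> (nat \<Rightarrow> 'a::field mat) \<Rightarrow> (nat \<Rightarrow> 'a mat)" where
  "theta1 q U = (THE X. \<exists>n V m W. is_P_canonical_form q U n V m W \<and>
     X = P_sum q Lambda_neg_seq n V m (\<lambda>j. map_mat theta (W j)))"

end

(*
The sequence of powers splits as A^k = P(k) + Q(k), where P has finite support and the entries of Q
are combinations of l^k (k choose j) with l non-zero.  Such a Q extends to all integers k, and the
extension satisfies a linear recurrence with non-zero trailing coefficient, so that it is determined
by its values at large k.  Since Q(k) = A^k for large k, the identities
A^k Q(l) = Q(l) A^k = Q(k+l) and Q(k) Q(l) = Q(k+l), clear for large arguments, hold for all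
integers.  Hence Q(-k) is the Drazin inverse of A^k for k > 0, and in any ring a Drazin inverse d of
a yields the unique complete inverse d + (a - a d a), which here is Q(-k) + P(k), the value of
theta_1.  A canonical form exists because the split characteristic polynomial, acting through the
shift, annihilates every entry of the sequence of powers.
*)

theory Submission
  imports Defs
begin

subsection \<open>Complete inverses from Drazin inverses\<close>

lemma (in ring) commute_pow:
  assumes "x \<in> carrier R" "y \<in> carrier R" "x \<otimes> y = y \<otimes> x"
  shows "x \<otimes> y [^] (n::nat) = y [^] n \<otimes> x"
  using assms by (induction n) (simp, simp add: m_assoc[symmetric], simp add: m_assoc)

lemma (in ring) commute_pow_mult:
  assumes "x \<in> carrier R" "y \<in> carrier R" "x \<otimes> y = y \<otimes> x"
  shows "(x \<otimes> y) [^] (n::nat) = x [^] n \<otimes> y [^] n"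
proof (induction n)
  case (Suc n)
  have "y [^] n \<otimes> (x \<otimes> y) = x \<otimes> (y [^] n \<otimes> y)"
    using commute_pow[OF assms, of n] assms by (metis m_assoc nat_pow_closed)
  then show ?case using Suc assms by (simp add: m_assoc)
qed simp

text \<open>With \<open>e = a d\<close> idempotent and commuting with \<open>a\<close>, the element
  \<open>x\<close> is \<open>d\<close> on the \<open>e\<close>-component and \<open>a\<close> on the
  complementary one, where \<open>a\<close> is nilpotent. For any \<open>y\<close> commuting with
  \<open>a\<close> the first defining equation reads \<open>a y (a - y) = a - y\<close>. Together
  with \<open>a - x = e (a - d)\<close> this gives existence; for a second solution \<open>y\<close>
  it forces \<open>a - y\<close> into the \<open>e\<close>-component, where \<open>y\<close>
  coincides with \<open>d\<close>.\<close>

lemma (in ring) complete_inverse_of_Drazin: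
  assumes [simp]: "a \<in> carrier R" "d \<in> carrier R"
    and ad: "a \<otimes> d = d \<otimes> a" and dad: "d \<otimes> a \<otimes> d = d"
    and n: "n > 0" and adn: "a [^] (n::nat) \<otimes> a \<otimes> d = a [^] n"
  shows "is_complete_inverse R a (d \<oplus> (a \<ominus> a \<otimes> d \<otimes> a))"
proof -
  define e where "e = a \<otimes> d"
  have [simp]: "e \<in> carrier R" by (simp add: e_def)
  have ee: "e \<otimes> e = e" by (simp add: e_def m_assoc dad[unfolded m_assoc[OF assms(2,1,2)]])
  have ed: "e \<otimes> d = d" using dad ad by (simp add: e_def)
  have de: "d \<otimes> e = d" using dad by (simp add: e_def m_assoc)
  have ae: "a \<otimes> e = e \<otimes> a" unfolding e_def by (metis ad m_assoc assms(1,2))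
  define x where "x = d \<oplus> (a \<ominus> e \<otimes> a)"
  have [simp]: "x \<in> carrier R" by (simp add: x_def)
  have ax: "a \<otimes> x = x \<otimes> a"
    unfolding x_def by (simp add: minus_eq r_distr l_distr r_minus l_minus ad ae m_assoc[symmetric])
  have ea: "e \<otimes> a \<otimes> e = e \<otimes> a" 
    by (simp add: m_assoc ae) (simp add: m_assoc[symmetric] ee)
  have amx: "a \<ominus> x = e \<otimes> (a \<ominus> d)"
  proof -
    have "a \<ominus> x = e \<otimes> a \<ominus> d"
      unfolding x_def by (simp add: minus_eq minus_add a_ac r_neg1 r_neg)
         (metis a_assoc a_closed a_comm a_inv_closed assms(1,2) m_closed minus_minus r_neg2 \<open>e \<in> carrier R\<close>)
    then show ?thesis by (simp add: minus_eq r_distr r_minus ed)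
  qed
  have axe: "a \<otimes> x \<otimes> e = e"
  proof -
    have xe: "x \<otimes> e = d" unfolding x_def by (simp add: minus_eq l_distr l_minus de ea ae r_neg)
    show ?thesis by (simp add: m_assoc xe) (simp add: e_def)
  qed
  have key: "a \<otimes> y \<otimes> a \<ominus> y \<otimes> a \<otimes> y = a \<otimes> y \<otimes> (a \<ominus> y)"
    if [simp]: "y \<in> carrier R" and "a \<otimes> y = y \<otimes> a" for y
    using that by (simp add: minus_eq r_distr r_minus)
  have "a \<otimes> x \<otimes> a \<ominus> x \<otimes> a \<otimes> x = a \<ominus> x"
    unfolding key[OF \<open>x \<in> carrier R\<close> ax] unfolding amx
    by (simp add: m_assoc[symmetric] axe)
  moreover have "a [^] n \<otimes> x \<otimes> a = a [^] n"
  proof -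
    have ane: "a [^] n \<otimes> e = a [^] n" using adn by (simp add: e_def m_assoc)
    have "a [^] n \<otimes> x \<otimes> a = a [^] n \<otimes> (a \<otimes> x)" by (simp add: m_assoc ax)
    also have "\<dots> = a [^] n \<otimes> e \<otimes> (a \<otimes> x)" by (simp add: ane)
    also have "\<dots> = a [^] n \<otimes> (a \<otimes> x \<otimes> e)"
    proof -
      have "e \<otimes> x = x \<otimes> e" unfolding x_def
        by (simp add: minus_eq l_distr l_minus r_distr r_minus de ed ae m_assoc[symmetric] ee ea)
      then have "e \<otimes> (a \<otimes> x) = a \<otimes> x \<otimes> e"
        by (metis ae m_assoc assms(1) \<open>x \<in> carrier R\<close> \<open>e \<in> carrier R\<close>)
      then show ?thesis by (simp add: m_assoc)
    qed
    also have "\<dots> = a [^] n" by (simp add: axe ane)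
    finally show ?thesis .
  qed
  ultimately have ex: "complete_inverse_eqs R a x"
    unfolding complete_inverse_eqs_def using ax n by auto
  have uniq: "y = x" if "complete_inverse_eqs R a y" for y
  proof -
    from that obtain m :: nat where [simp]: "y \<in> carrier R" and ay: "a \<otimes> y = y \<otimes> a"
      and yeq: "a \<otimes> y \<otimes> a \<ominus> y \<otimes> a \<otimes> y = a \<ominus> y"
      and m: "m > 0" "a [^] m \<otimes> y \<otimes> a = a [^] m"
      unfolding complete_inverse_eqs_def by auto
    \<comment> \<open>Large enough for both power conditions, the one satisfied by \<open>d\<close>
      and the one satisfied by \<open>y\<close>.\<close>
    define M where "M = n + m"
    define f where "f = \<one> \<ominus> e"
    have [simp]: "f \<in> carrier R" by (simp add: f_def)
    have fe: "\<one> = f \<oplus> e" unfolding f_def by (simp add: minus_eq a_assoc l_neg)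
    have "a [^] M = a [^] m \<otimes> a [^] n" by (simp add: M_def nat_pow_mult add.commute)
    then have aMe: "a [^] M \<otimes> e = a [^] M" 
      using adn by (simp add: e_def m_assoc)
    have eM: "e \<otimes> a [^] M = a [^] M \<otimes> e" by (rule commute_pow) (simp_all add: ae)
    have aMf: "a [^] M \<otimes> f = \<zero>" and faM: "f \<otimes> a [^] M = \<zero>"
      unfolding f_def by (simp_all add: minus_eq l_distr r_distr l_minus r_minus aMe eM r_neg)
    have aMy: "a [^] M \<otimes> a \<otimes> y = a [^] M"
    proof -
      have "a [^] M = a [^] n \<otimes> a [^] m" by (simp add: M_def nat_pow_mult)
      then show ?thesis using m(2) by (simp add: m_assoc ay)
    qed
    have eMe: "e [^] Suc i = e" for i :: nat by (induction i) (simp_all add: ee)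
    have adM: "a [^] i \<otimes> d [^] i = e [^] i" for i :: nat
      unfolding e_def by (rule commute_pow_mult[symmetric]) (simp_all add: ad)
    have daM: "d [^] i \<otimes> a [^] i = e [^] i" for i :: nat
      using commute_pow_mult[of d a i] by (simp add: e_def ad)
    \<comment> \<open>Since \<open>M > 0\<close>, idempotence gives \<open>d^M a^M = e\<close>, so a
      factor \<open>a^M\<close> can be split off from \<open>d\<close> on either side.\<close>
    have dM: "d = d [^] Suc M \<otimes> a [^] M" "d = a [^] M \<otimes> d [^] Suc M"
    proof -
      obtain k where k: "M = Suc k" using n M_def not0_implies_Suc[of M] by auto
      show "d = a [^] M \<otimes> d [^] Suc M"
        using adM[of M] eMe[of k] ed by (simp add: k m_assoc[symmetric])
      have "d [^] Suc M \<otimes> a [^] M = d \<otimes> (d [^] M \<otimes> a [^] M)"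
        using commute_pow[of d d M] by (simp add: m_assoc[symmetric])
      then show "d = d [^] Suc M \<otimes> a [^] M"
        using daM[of M] eMe[of k] de by (simp only: k)
    qed
    have yaM: "y \<otimes> a [^] M = a [^] M \<otimes> y" by (rule commute_pow) (simp_all add: ay)
    \<comment> \<open>The factor \<open>a^M\<close> split off from \<open>d\<close> moves past
      \<open>y\<close> and meets \<open>f\<close>, which annihilates it.\<close>
    have dyf: "d \<otimes> y \<otimes> f = \<zero>"
    proof -
      have "d \<otimes> y \<otimes> f = d [^] Suc M \<otimes> (y \<otimes> a [^] M) \<otimes> f"
        by (subst dM(1)) (simp add: m_assoc yaM del: nat_pow_Suc)
      also have "\<dots> = \<zero>" by (simp add: m_assoc aMf del: nat_pow_Suc)
      finally show ?thesis .
    qed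
    have fyd: "f \<otimes> y \<otimes> d = \<zero>"
    proof -
      have "f \<otimes> y \<otimes> d = f \<otimes> (y \<otimes> a [^] M) \<otimes> d [^] Suc M"
        by (subst dM(2)) (simp add: m_assoc del: nat_pow_Suc)
      also have "\<dots> = (f \<otimes> a [^] M) \<otimes> y \<otimes> d [^] Suc M"
        unfolding yaM by (simp add: m_assoc del: nat_pow_Suc)
      finally show ?thesis by (simp add: faM)
    qed
    have dy: "d \<otimes> y = y \<otimes> d"
    proof -
      have "d \<otimes> y = d \<otimes> y \<otimes> (f \<oplus> e)" by (simp flip: fe)
      also have "\<dots> = d \<otimes> y \<otimes> a \<otimes> d" by (simp add: r_distr dyf) (simp add: e_def m_assoc)
      also have "\<dots> = e \<otimes> y \<otimes> d" by (simp add: e_def ad m_assoc ay)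
      also have "\<dots> = (f \<oplus> e) \<otimes> y \<otimes> d" by (simp add: l_distr fyd)
      finally show ?thesis by (simp flip: fe)
    qed
    have ey: "e \<otimes> y = d"
    proof -
      have "d = d [^] Suc M \<otimes> (a [^] M \<otimes> a \<otimes> y)" using dM(1) by (simp only: aMy)
      also have "\<dots> = d [^] Suc M \<otimes> a [^] Suc M \<otimes> y" by (simp add: m_assoc)
      also have "\<dots> = e \<otimes> y" unfolding daM eMe ..
      finally show ?thesis by simp
    qed
    define w where "w = a \<ominus> y"
    have [simp]: "w \<in> carrier R" by (simp add: w_def)
    have ayw: "a \<otimes> y \<otimes> w = w" using yeq unfolding key[OF \<open>y \<in> carrier R\<close> ay] w_def .
    \<comment> \<open>Iterating \<open>a y w = w\<close> brings out a factor \<open>a^M\<close> on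
      the left of \<open>w\<close>, and \<open>f\<close> annihilates that factor.\<close>
    have "(a \<otimes> y) [^] i \<otimes> w = w" for i :: nat
      by (induction i) (simp_all add: m_assoc ayw[unfolded m_assoc[OF assms(1) \<open>y \<in> carrier R\<close> \<open>w \<in> carrier R\<close>]])
    then have "a [^] M \<otimes> y [^] M \<otimes> w = w" using commute_pow_mult[of a y M] ay by (metis \<open>y \<in> carrier R\<close> assms(1))
    then have fw: "f \<otimes> w = \<zero>"
      using faM by (metis m_assoc l_null nat_pow_closed assms(1) \<open>y \<in> carrier R\<close> \<open>w \<in> carrier R\<close> \<open>f \<in> carrier R\<close> m_closed)
    have "w = (f \<oplus> e) \<otimes> w" by (simp flip: fe)
    also have "\<dots> = e \<otimes> w" by (simp add: l_distr fw)
    also have "\<dots> = e \<otimes> a \<ominus> d" by (simp add: w_def minus_eq r_distr r_minus ey)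
    finally have "a \<ominus> y = a \<ominus> x" unfolding w_def amx by (simp add: minus_eq r_distr r_minus ed)
    then show "y = x"
      by (simp add: minus_eq) (metis \<open>x \<in> carrier R\<close> \<open>y \<in> carrier R\<close> minus_minus)
  qed
  show ?thesis
    unfolding is_complete_inverse_def using ex uniq unfolding x_def e_def by blast
qed

subsection \<open>Two-sided recurrent sequences\<close>

text \<open>
  Two-sided sequences annihilated by a product of operators \<open>E - l\<close> with \<open>l \<noteq> 0\<close>, where \<open>E\<close> is the
  shift.
\<close>

inductive_set birec :: "(int \<Rightarrow> 'a::field) set" where
  zero: "(\<lambda>_. 0) \<in> birec"
| step: "l \<noteq> 0 \<Longrightarrow> (\<lambda>k. g (k + 1) - l * g k) \<in> birec \<Longrightarrow> g \<in> birec"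

lemma birec_scale: "g \<in> birec \<Longrightarrow> (\<lambda>k. c * g k) \<in> birec"
proof (induction rule: birec.induct)
  case (step l g)
  then show ?case by - (rule birec.step[of l], auto simp: algebra_simps)
qed (simp add: birec.zero)

lemma birec_shift: "g \<in> birec \<Longrightarrow> (\<lambda>k. g (m + k)) \<in> birec"
proof (induction rule: birec.induct)
  case (step l g)
  then show ?case by - (rule birec.step[of l], auto simp: algebra_simps)
qed (simp add: birec.zero)

text \<open>Applying \<open>E - l\<close> commutes with the operators that annihilate
  \<open>g\<close>. In \<open>birec_add\<close> the induction on one summand turns the other into
  its image under \<open>E - l\<close>, and this lemma keeps that image in
  \<open>birec\<close>.\<close>

lemma birec_diff_scale: "g \<in> birec \<Longrightarrow> (\<lambda>k. g (k + 1) - l * g k) \<in> birec"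
proof (induction rule: birec.induct)
  case (step m g)
  show ?case
    using step.IH by - (rule birec.step[OF step.hyps(1)], simp add: algebra_simps)
qed (simp add: birec.zero)

lemma birec_add: "g \<in> birec \<Longrightarrow> h \<in> birec \<Longrightarrow> (\<lambda>k. g k + h k) \<in> birec"
proof (induction arbitrary: h rule: birec.induct)
  case (step l g)
  show ?case
    using step.IH[OF birec_diff_scale[OF step.prems, of l]]
    by - (rule birec.step[OF step.hyps(1)], simp add: algebra_simps)
qed simp

lemma birec_diff: "g \<in> birec \<Longrightarrow> h \<in> birec \<Longrightarrow> (\<lambda>k. g k - h k) \<in> birec"
  using birec_add[of g "\<lambda>k. (- 1) * h k"] birec_scale[of h "- 1"] by simp

lemma birec_sum: "(\<And>i. i \<in> I \<Longrightarrow> g i \<in> birec) \<Longrightarrow> (\<lambda>k. \<Sum>i\<in>I. g i k) \<in> birec"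
  by (induction I rule: infinite_finite_induct) (auto intro: birec.zero birec_add)

text \<open>The recurrence can be run backwards because its trailing coefficient is non-zero.\<close>

lemma birec_eventually_zero:
  assumes "g \<in> birec" "\<And>k. k \<ge> K \<Longrightarrow> g k = 0"
  shows "g k = 0"
  using assms
proof (induction arbitrary: k rule: birec.induct)
  case (step l g)
  have rec: "g (k + 1) - l * g k = 0" for k
    by (rule step.IH) (simp add: step.prems)
  show ?case
  proof (cases "k \<le> K")
    case True
    then show ?thesis
    proof (induction k rule: int_le_induct)
      case (step i)
      then show ?case using rec[of "i - 1"] \<open>l \<noteq> 0\<close> by simp
    qed (simp add: step.prems)
  qed (simp add: step.prems)
qed simp

text \<open>The transfer principle of the development: an identity that is clear for large arguments
  extends to every integer, in particular to the negative ones.\<close>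

lemma birec_eqI:
  assumes "g \<in> birec" "h \<in> birec" "\<And>k. k \<ge> K \<Longrightarrow> g k = h k"
  shows "g k = h k"
  using birec_eventually_zero[OF birec_diff[OF assms(1,2)], of K k] assms(3) by simp

section \<open>Binomial coefficients at all integers\<close>

text \<open>The binomial coefficient \<open>k choose j\<close> for integer \<open>k\<close>, glued
  from the two given families. They agree at \<open>k = 0\<close>, so either formula can be used
  there.\<close>

definition bi_choose :: "nat \<Rightarrow> int \<Rightarrow> 'a::field" where
  "bi_choose j k = (if k \<ge> 0 then Lambda_seq j (nat k) else Lambda_neg_seq j (nat (- k)))"

lemma bi_choose_int [simp]: "bi_choose j (int k) = Lambda_seq j k"
  by (simp add: bi_choose_def)

lemma bi_choose_minus_int [simp]: "bi_choose j (- int k) = Lambda_neg_seq j k"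
  by (cases "k = 0"; cases j) (simp_all add: bi_choose_def Lambda_seq_def Lambda_neg_seq_def binomial_eq_0)

lemma bi_choose_0 [simp]: "bi_choose 0 k = 1"
  by (simp add: bi_choose_def Lambda_seq_def Lambda_neg_seq_def)

text \<open>On the negative side this is Pascal's rule for \<open>(k + j - 1) choose j\<close> with
  alternating signs. It is what makes \<open>E - l\<close> lower the order \<open>j\<close> of
  \<open>l powi k * bi_choose j k\<close>.\<close>

lemma bi_choose_Pascal: "bi_choose (Suc j) (k + 1) = bi_choose (Suc j) k + bi_choose j k"
proof (cases "k \<ge> 0")
  case True
  then obtain n where n: "k = int n" using nonneg_int_cases by blast
  then have k: "k + 1 = int (Suc n)" by simp
  show ?thesis
    unfolding k unfolding n bi_choose_int by (simp add: Lambda_seq_def)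
next
  case False
  \<comment> \<open>With \<open>k = -(n + 1)\<close> the successor \<open>k + 1 = -n\<close> can be
    read off from the negative family even when it is 0.\<close>
  then obtain n where n: "k = - int (Suc n)" by (metis int_cases of_nat_0_le_iff)
  then have k: "k + 1 = - int n" by simp
  show ?thesis
    unfolding k unfolding n bi_choose_minus_int
    by (cases j) (simp_all add: Lambda_neg_seq_def distrib_left)
qed

section \<open>Two-sided combinations of geometric sequences\<close>

text \<open>Generated one term at a time, with repeated bases and zero coefficients allowed, so that
  closure properties follow by induction without comparing coefficients.\<close>

inductive_set bigeom :: "(int \<Rightarrow> 'a::field) set" where
  zero: "(\<lambda>_. 0) \<in> bigeom"
| step: "l \<noteq> 0 \<Longrightarrow> g \<in> bigeom \<Longrightarrow> (\<lambda>k. c * l powi k + g k) \<in> bigeom"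

lemma bigeom_powi: "l \<noteq> 0 \<Longrightarrow> (\<lambda>k. c * l powi k) \<in> bigeom"
  using bigeom.step[OF _ bigeom.zero, of l c] by simp

lemma bigeom_add: "g \<in> bigeom \<Longrightarrow> h \<in> bigeom \<Longrightarrow> (\<lambda>k. g k + h k) \<in> bigeom"
  by (induction rule: bigeom.induct) (auto simp: add.assoc intro: bigeom.step)

lemma bigeom_mult_powi: "g \<in> bigeom \<Longrightarrow> m \<noteq> 0 \<Longrightarrow> (\<lambda>k. c * m powi k * g k) \<in> bigeom"
proof (induction rule: bigeom.induct)
  case (step l g d)
  then show ?case
    using bigeom.step[of "m * l" "\<lambda>k. c * m powi k * g k" "c * d"]
    by (simp add: power_int_mult_distrib algebra_simps)
qed (simp add: bigeom.zero)

lemma bigeom_scale: "g \<in> bigeom \<Longrightarrow> (\<lambda>k. c * g k) \<in> bigeom"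
  using bigeom_mult_powi[of g 1 c] by simp

lemma bigeom_mult: "g \<in> bigeom \<Longrightarrow> h \<in> bigeom \<Longrightarrow> (\<lambda>k. g k * h k) \<in> bigeom"
  by (induction rule: bigeom.induct)
     (auto simp: distrib_right intro: bigeom.zero bigeom_add bigeom_mult_powi)

text \<open>Reflection replaces \<open>l\<close> by \<open>inverse l\<close>, which is how
  \<open>theta\<close> acts on a geometric sequence.\<close>

lemma bigeom_reflect: "g \<in> bigeom \<Longrightarrow> (\<lambda>k. g (- k)) \<in> bigeom"
proof (induction rule: bigeom.induct)
  case (step l g c)
  then show ?case
    using bigeom.step[of "inverse l" "\<lambda>k. g (- k)" c]
    by (simp add: power_int_inverse power_int_minus)
qed (simp add: bigeom.zero)

text \<open>By Pascal's rule \<open>E - l\<close> sends order \<open>Suc j\<close> to order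
  \<open>j\<close> and multiplies the coefficient by \<open>l\<close>, hence the arbitrary
  \<open>c\<close> in the induction. At order 0 it gives zero.\<close>

lemma powi_bi_choose_birec:
  assumes "l \<noteq> 0"
  shows "(\<lambda>k. c * l powi k * bi_choose j k) \<in> birec"
proof (induction j arbitrary: c)
  case 0
  show ?case
    by (rule birec.step[OF assms]) (simp add: power_int_add_1 assms birec.zero algebra_simps)
next
  case (Suc j)
  show ?case
    using Suc[of "c * l"]
    by - (rule birec.step[OF assms],
        simp add: power_int_add_1 assms bi_choose_Pascal algebra_simps)
qed

lemma bigeom_bi_choose_birec: "g \<in> bigeom \<Longrightarrow> (\<lambda>k. g k * bi_choose j k) \<in> birec"
  by (induction rule: bigeom.induct)
     (auto simp: distrib_right intro: birec.zero birec_add powi_bi_choose_birec)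

lemma bigeom_eqI:
  assumes "g \<in> bigeom" "h \<in> bigeom" "\<And>k. g (int k) = h (int k)"
  shows "g = h"
proof
  have "g k = h k" if "k \<ge> 0" for k
    using assms(3)[of "nat k"] that by simp
  moreover have "g \<in> birec" "h \<in> birec"
    using bigeom_bi_choose_birec[of _ 0] assms(1,2) by auto
  ultimately show "g k = h k" for k
    by (rule birec_eqI[of _ _ 0, rotated -1])
qed

section \<open>The automorphism \<open>theta\<close> as a reflection\<close>

lemma geom_span_iff_bigeom: "w \<in> geom_span \<longleftrightarrow> (\<exists>g\<in>bigeom. \<forall>k. w k = g (int k))"
proof
  assume "w \<in> geom_span"
  then show "\<exists>g\<in>bigeom. \<forall>k. w k = g (int k)"
    unfolding geom_span_def
  proof (induction rule: seq_space.span_induct_alt)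
    case base
    show ?case by (rule bexI[OF _ bigeom.zero]) simp
  next
    case (step c x y)
    then obtain l g where "x = geom_seq l" "l \<noteq> 0" "g \<in> bigeom" "\<forall>k. y k = g (int k)" by auto
    then show ?case
      by (intro bexI[OF _ bigeom.step[of l g c]]) (auto simp: seq_scale_def geom_seq_def)
  qed
next
  have "g \<in> bigeom \<Longrightarrow> (\<lambda>k. g (int k)) \<in> geom_span" for g :: "int \<Rightarrow> 'a"
  proof (induction rule: bigeom.induct)
    case zero
    show ?case
      unfolding geom_span_def using seq_space.span_zero by (simp add: zero_fun_def)
  next
    case (step l g c)
    have "seq_scale c (geom_seq l) + (\<lambda>k. g (int k)) \<in> geom_span"
      using step.hyps(1) step.IH unfolding geom_span_def
      by (auto intro: seq_space.span_add seq_space.span_scale seq_space.span_base)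
    then show ?case by (simp add: seq_scale_def geom_seq_def plus_fun_def)
  qed
  moreover assume "\<exists>g\<in>bigeom. \<forall>k. w k = g (int k)"
  then obtain g where "g \<in> bigeom" "w = (\<lambda>k. g (int k))" by (auto simp: fun_eq_iff)
  ultimately show "w \<in> geom_span" by simp
qed

text \<open>Meaningful on \<open>geom_span\<close> only: there an extension exists by
  \<open>geom_span_iff_bigeom\<close> and is unique by \<open>bigeom_eqI\<close>. Uniqueness also
  makes it compatible with sums, products and scalars.\<close>

definition geom_ext :: "(nat \<Rightarrow> 'a::field) \<Rightarrow> int \<Rightarrow> 'a" where
  "geom_ext w = (THE g. g \<in> bigeom \<and> (\<forall>k. w k = g (int k)))"

lemma geom_ext_eqI:
  assumes "g \<in> bigeom" "\<And>k. w k = g (int k)"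
  shows "geom_ext w = g"
  unfolding geom_ext_def
proof (rule the_equality)
  show "h = g" if "h \<in> bigeom \<and> (\<forall>k. w k = h (int k))" for h
    using that assms by (intro bigeom_eqI) auto
qed (use assms in auto)

lemma geom_ext:
  assumes "w \<in> geom_span"
  shows "geom_ext w \<in> bigeom" "geom_ext w (int k) = w k"
proof -
  obtain g where "g \<in> bigeom" "\<And>k. w k = g (int k)" using assms geom_span_iff_bigeom by blast
  then show "geom_ext w \<in> bigeom" "geom_ext w (int k) = w k" using geom_ext_eqI[of g w] by auto
qed

text \<open>The explicit model of \<open>theta\<close>: the extension to all integers, read
  backwards.\<close>

definition geom_reflect :: "(nat \<Rightarrow> 'a::field) \<Rightarrow> nat \<Rightarrow> 'a" where
  "geom_reflect w = (\<lambda>k. geom_ext w (- int k))"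

lemma geom_reflect_in:
  assumes "w \<in> geom_span"
  shows "geom_reflect w \<in> geom_span"
  unfolding geom_span_iff_bigeom geom_reflect_def
  by (rule bexI[OF _ bigeom_reflect[OF geom_ext(1)[OF assms]]]) simp

lemma geom_ext_geom_reflect:
  "w \<in> geom_span \<Longrightarrow> geom_ext (geom_reflect w) = (\<lambda>k. geom_ext w (- k))"
  by (intro geom_ext_eqI bigeom_reflect geom_ext) (simp_all add: geom_reflect_def)

lemma geom_reflect_reflect: "w \<in> geom_span \<Longrightarrow> geom_reflect (geom_reflect w) = w"
  by (simp add: geom_reflect_def[of "geom_reflect w"] geom_ext_geom_reflect geom_ext(2))

lemma geom_ext_add:
  "v \<in> geom_span \<Longrightarrow> w \<in> geom_span \<Longrightarrow> geom_ext (v + w) = (\<lambda>k. geom_ext v k + geom_ext w k)"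
  by (intro geom_ext_eqI bigeom_add geom_ext) (auto simp: geom_ext)

lemma geom_ext_mult:
  "v \<in> geom_span \<Longrightarrow> w \<in> geom_span \<Longrightarrow> geom_ext (v * w) = (\<lambda>k. geom_ext v k * geom_ext w k)"
  by (intro geom_ext_eqI bigeom_mult geom_ext) (auto simp: geom_ext)

lemma geom_ext_scale:
  "w \<in> geom_span \<Longrightarrow> geom_ext (seq_scale c w) = (\<lambda>k. c * geom_ext w k)"
  by (intro geom_ext_eqI bigeom_scale geom_ext) (auto simp: geom_ext seq_scale_def)

lemma geom_ext_geom_seq: "l \<noteq> 0 \<Longrightarrow> geom_ext (geom_seq l) = (\<lambda>k. l powi k)"
  using bigeom_powi[of l 1] by (intro geom_ext_eqI) (auto simp: geom_seq_def)

lemma geom_span_mult: "v \<in> geom_span \<Longrightarrow> w \<in> geom_span \<Longrightarrow> v * w \<in> geom_span"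
  unfolding geom_span_iff_bigeom[of "v * w"]
  by (rule bexI[OF _ bigeom_mult[OF geom_ext(1)[of v] geom_ext(1)[of w]]]) (simp_all add: geom_ext(2))

text \<open>Bijectivity holds because the map is an involution on \<open>geom_span\<close>; the
  algebra laws are those of the extension, evaluated at \<open>-k\<close>.\<close>

lemma is_theta_geom_reflect: "is_theta (restrict geom_reflect geom_span)"
proof -
  have cl: "v + w \<in> geom_span" "v * w \<in> geom_span" "seq_scale c w \<in> geom_span"
    if "v \<in> geom_span" "w \<in> geom_span" for v w :: "nat \<Rightarrow> 'a" and c
    using that geom_span_mult
    by (auto simp: geom_span_def intro: seq_space.span_add seq_space.span_scale)
  have geom: "geom_seq l \<in> geom_span" if "l \<noteq> 0" for l :: 'a
    unfolding geom_span_def using that by (intro seq_space.span_base) auto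
  have one: "1 = (geom_seq 1 :: nat \<Rightarrow> 'a)" by (auto simp: geom_seq_def)
  have gr: "geom_reflect (geom_seq l) = geom_seq (inverse l)" if "l \<noteq> 0" for l :: 'a
    using that unfolding geom_reflect_def geom_ext_geom_seq[OF that]
    by (simp add: geom_seq_def power_int_minus power_inverse)
  let ?f = "restrict geom_reflect (geom_span :: (nat \<Rightarrow> 'a) set)"
  have "bij_betw ?f geom_span geom_span"
    by (rule bij_betwI[of _ _ _ ?f]) (simp_all add: geom_reflect_in geom_reflect_reflect)
  moreover have "?f (v + w) = ?f v + ?f w" "?f (v * w) = ?f v * ?f w"
    if "v \<in> geom_span" "w \<in> geom_span" for v w
    using that cl[OF that] by (simp_all add: geom_reflect_def geom_ext_add geom_ext_mult fun_eq_iff)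
  moreover have "?f (seq_scale c w) = seq_scale c (?f w)" if "w \<in> geom_span" for c w
    using that cl(3)[OF that that]
    by (simp add: geom_reflect_def geom_ext_scale) (simp add: seq_scale_def)
  moreover have "?f (geom_seq l) = geom_seq (inverse l)" if "l \<noteq> 0" for l
    using that by (simp add: geom gr)
  moreover have "?f 1 = 1"
    unfolding one by (simp add: geom gr)
  ultimately show ?thesis
    unfolding is_theta_def by blast
qed

text \<open>Additivity and homogeneity determine an admissible map on \<open>geom_span\<close> from
  its values on geometric sequences; extensionality fixes it elsewhere.\<close>

lemma theta_eq: "theta = restrict geom_reflect geom_span"
  unfolding theta_def
proof (rule the_equality)
  fix f :: "(nat \<Rightarrow> 'a) \<Rightarrow> nat \<Rightarrow> 'a"
  assume f: "is_theta f \<and> f \<in> extensional geom_span"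
  have "g \<in> bigeom \<Longrightarrow> f (\<lambda>k. g (int k)) = (\<lambda>k. g (- int k))" for g
  proof (induction rule: bigeom.induct)
    case zero
    have "0 \<in> (geom_span :: (nat \<Rightarrow> 'a) set)"
      unfolding geom_span_def by (rule seq_space.span_zero)
    then have "f (0 + 0) = f 0 + f 0" using f unfolding is_theta_def by blast
    then have "f 0 = 0" by simp
    then show ?case by (simp add: zero_fun_def)
  next
    case (step l g c)
    have 1: "geom_seq l \<in> geom_span" "seq_scale c (geom_seq l) \<in> geom_span"
      using step(1) unfolding geom_span_def
      by (auto intro: seq_space.span_scale seq_space.span_base)
    have 2: "(\<lambda>k. g (int k)) \<in> geom_span" using step(2) geom_span_iff_bigeom by blast
    have "f (seq_scale c (geom_seq l) + (\<lambda>k. g (int k)))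
        = seq_scale c (geom_seq (inverse l)) + (\<lambda>k. g (- int k))"
      using f 1 2 step unfolding is_theta_def by simp
    then show ?case
      by (simp add: seq_scale_def geom_seq_def plus_fun_def power_int_minus power_inverse)
  qed
  note f_bigeom = this
  show "f = restrict geom_reflect geom_span"
  proof (rule extensionalityI[where A = geom_span])
    fix w :: "nat \<Rightarrow> 'a" assume w: "w \<in> geom_span"
    then show "f w = restrict geom_reflect geom_span w"
      using f_bigeom[OF geom_ext(1)[OF w]] by (simp add: geom_ext geom_reflect_def)
  qed (use f in auto)
qed (use is_theta_geom_reflect in auto)

lemma theta_apply: "w \<in> geom_span \<Longrightarrow> theta w k = geom_ext w (- int k)"
  by (simp add: theta_eq geom_reflect_def)

subsection \<open>Existence of canonical forms\<close>

text \<open>Substituting the shift for the variable makes the scalar sequences a module over the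
  polynomials; \<open>shift_act_mult\<close> is the associativity law.\<close>

definition shift_act :: "'a::field poly \<Rightarrow> (nat \<Rightarrow> 'a) \<Rightarrow> nat \<Rightarrow> 'a" where
  "shift_act p s = (\<lambda>k. \<Sum>i\<le>degree p. coeff p i * s (k + i))"

text \<open>Any larger bound may replace \<open>degree p\<close>, so that polynomials of different
  degrees can be added termwise.\<close>

lemma shift_act_altdef:
  "degree p \<le> N \<Longrightarrow> shift_act p s k = (\<Sum>i\<le>N. coeff p i * s (k + i))"
  unfolding shift_act_def by (rule sum.mono_neutral_left) (auto simp: coeff_eq_0)

lemma shift_act_0 [simp]: "shift_act 0 s = (\<lambda>_. 0)"
  by (simp add: shift_act_def)

lemma shift_act_zero_seq [simp]: "shift_act p (\<lambda>_. 0) = (\<lambda>_. 0)"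
  by (simp add: shift_act_def)

lemma shift_act_add: "shift_act (p + q) s k = shift_act p s k + shift_act q s k"
proof -
  define N where "N = max (degree p) (degree q)"
  have "degree p \<le> N" "degree q \<le> N" "degree (p + q) \<le> N"
    by (auto simp: N_def degree_add_le_max)
  then show ?thesis
    by (simp add: shift_act_altdef[of _ N] sum.distrib distrib_right)
qed

lemma shift_act_smult: "shift_act (Polynomial.smult c p) s k = c * shift_act p s k"
  using shift_act_altdef[OF degree_smult_le[of c p]]
  by (simp add: shift_act_def sum_distrib_left mult.assoc)

lemma shift_act_pCons: "shift_act (pCons a p) s k = a * s k + shift_act p s (Suc k)"
  using shift_act_altdef[OF degree_pCons_le[of a p]]
  by (simp add: shift_act_def sum.atMost_Suc_shift del: sum.atMost_Suc)

lemma shift_act_mult: "shift_act (p * q) s k = shift_act p (shift_act q s) k"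
proof (induction p arbitrary: k)
  case (pCons a p)
  then show ?case
    by (simp add: shift_act_pCons shift_act_add shift_act_smult)
qed simp

lemma shift_act_sum: "shift_act (\<Sum>i\<in>I. p i) s k = (\<Sum>i\<in>I. shift_act (p i) s k)"
  by (induction I rule: infinite_finite_induct) (simp_all add: shift_act_add)

lemma shift_act_sum_seq:
  "shift_act p (\<lambda>k. \<Sum>j\<in>J. s j k) k = (\<Sum>j\<in>J. shift_act p (s j) k)"
  unfolding shift_act_def sum_distrib_left by (rule sum.swap)

lemma index_mat_mult_sum:
  assumes "A \<in> carrier_mat q q" "B \<in> carrier_mat q q" "i < q" "j < q"
  shows "(A * B) $$ (i, j) = (\<Sum>k<q. A $$ (i, k) * B $$ (k, j))"
  using assms by (simp add: scalar_prod_def lessThan_atLeast0)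

lemma pow_mat_Suc_left:
  assumes "(A :: 'a::semiring_1 mat) \<in> carrier_mat q q"
  shows "A ^\<^sub>m Suc k = A * A ^\<^sub>m k"
proof (induction k)
  case (Suc k)
  have "A ^\<^sub>m Suc (Suc k) = A * A ^\<^sub>m k * A" using Suc by simp
  also have "\<dots> = A * (A ^\<^sub>m k * A)"
    by (rule assoc_mult_mat) (use assms in auto)
  finally show ?case by simp
qed (use assms in simp)

text \<open>
  The determinant trick behind the Cayley-Hamilton theorem: \<open>x I - A\<close>, with \<open>x\<close> acting as the shift,
  kills every column of \<open>(A\<^sup>k)\<close>, and so does its product with the adjugate.
\<close>

lemma shift_act_char_poly:
  fixes A :: "'a::field mat"
  assumes A: "A \<in> carrier_mat q q" and r: "r < q" and c: "c < q"
  shows "shift_act (char_poly A) (\<lambda>k. (A ^\<^sub>m k) $$ (r, c)) k = 0"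
proof -
  define M where "M = char_poly_matrix A"
  define B where "B = adj_mat M"
  define s where "s = (\<lambda>j k. (A ^\<^sub>m k) $$ (j, c))"
  have M: "M \<in> carrier_mat q q" using A by (simp add: M_def)
  have B: "B \<in> carrier_mat q q" and BM: "B * M = char_poly A \<cdot>\<^sub>m 1\<^sub>m q"
    using adj_mat[OF M] by (simp_all add: B_def M_def char_poly_def)
  have act_M: "shift_act (M $$ (i, j)) (s j) k = (if i = j then s j (Suc k) else 0) - A $$ (i, j) * s j k"
    if "i < q" "j < q" for i j k
    using that A by (simp add: M_def char_poly_matrix_def shift_act_add shift_act_pCons one_pCons)
  \<comment> \<open>Row \<open>i\<close> of \<open>x I - A\<close>, applied to column
    \<open>c\<close> of the powers, expresses the recurrence \<open>A^(k+1) = A A^k\<close>.\<close>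
  have kill: "(\<Sum>j<q. shift_act (M $$ (i, j)) (s j) k) = 0" if i: "i < q" for i k
  proof -
    have "s i (Suc k) = (\<Sum>j<q. A $$ (i, j) * s j k)"
      unfolding s_def pow_mat_Suc_left[OF A] by (rule index_mat_mult_sum) (use A i c in simp_all)
    then show ?thesis using i by (simp add: act_M sum_subtractf)
  qed
  have BM_entry: "(\<Sum>i<q. B $$ (r, i) * M $$ (i, j)) = (if r = j then char_poly A else 0)" if j: "j < q" for j
  proof -
    have "(\<Sum>i<q. B $$ (r, i) * M $$ (i, j)) = (B * M) $$ (r, j)"
      using index_mat_mult_sum[OF B M r j] by simp
    then show ?thesis using r j by (simp add: BM)
  qed
  \<comment> \<open>Row \<open>r\<close> of \<open>B * M\<close> isolates the entry
    \<open>s r\<close>; exchanging the two sums leaves \<open>M\<close> acting first, where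
    \<open>kill\<close> applies.\<close>
  have "shift_act (char_poly A) (s r) k = (\<Sum>j<q. shift_act (if r = j then char_poly A else 0) (s j) k)"
    using r by (simp add: if_distrib[of "\<lambda>p. shift_act p _ _"] cong: if_cong)
  also have "\<dots> = (\<Sum>j<q. \<Sum>i<q. shift_act (B $$ (r, i)) (shift_act (M $$ (i, j)) (s j)) k)"
    by (intro sum.cong) (simp_all add: BM_entry[symmetric] shift_act_sum shift_act_mult)
  also have "\<dots> = (\<Sum>i<q. shift_act (B $$ (r, i)) (\<lambda>k. \<Sum>j<q. shift_act (M $$ (i, j)) (s j) k) k)"
    unfolding shift_act_sum_seq by (rule sum.swap)
  also have "\<dots> = 0" by (simp add: kill)
  finally show ?thesis by (simp add: s_def)
qed

section \<open>Solving \<open>(E - a) g = t\<close> among scalar canonical sequences\<close>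

text \<open>A span allows induction over generators; explicit coefficients are recovered in
  \<open>has_P_form_if_P_span\<close>.\<close>

definition P_span :: "(nat \<Rightarrow> 'a::field) set" where
  "P_span = seq_space.span
     (range delta_seq \<union> (\<lambda>(l, j). geom_seq l * Lambda_seq j) ` ((- {0}) \<times> UNIV))"

lemma P_span_delta: "delta_seq i \<in> P_span"
  unfolding P_span_def by (intro seq_space.span_base) auto

lemma P_span_geom: "l \<noteq> 0 \<Longrightarrow> geom_seq l * Lambda_seq j \<in> P_span"
  unfolding P_span_def by (intro seq_space.span_base) auto

lemma P_span_add: "s \<in> P_span \<Longrightarrow> t \<in> P_span \<Longrightarrow> s + t \<in> P_span"
  unfolding P_span_def by (rule seq_space.span_add)

lemma P_span_scale: "s \<in> P_span \<Longrightarrow> seq_scale c s \<in> P_span"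
  unfolding P_span_def by (rule seq_space.span_scale)

definition shift_diff :: "'a::field \<Rightarrow> (nat \<Rightarrow> 'a) \<Rightarrow> nat \<Rightarrow> 'a" where
  "shift_diff a s = (\<lambda>k. s (Suc k) - a * s k)"

lemma shift_diff_add: "shift_diff a (s + t) = shift_diff a s + shift_diff a t"
  by (simp add: shift_diff_def fun_eq_iff algebra_simps)

lemma shift_diff_scale: "shift_diff a (seq_scale c s) = seq_scale c (shift_diff a s)"
  by (simp add: shift_diff_def seq_scale_def fun_eq_iff algebra_simps)

lemma shift_diff_delta_0: "shift_diff a (delta_seq 0) = seq_scale (- a) (delta_seq 0)"
  by (simp add: shift_diff_def delta_seq_def seq_scale_def fun_eq_iff)

lemma shift_diff_delta_Suc:
  "shift_diff a (delta_seq (Suc i)) = delta_seq i + seq_scale (- a) (delta_seq (Suc i))"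
  by (simp add: shift_diff_def delta_seq_def seq_scale_def fun_eq_iff)

lemma shift_diff_geom_0:
  "shift_diff a (geom_seq l * Lambda_seq 0) = seq_scale (l - a) (geom_seq l * Lambda_seq 0)"
  by (simp add: shift_diff_def geom_seq_def Lambda_seq_def seq_scale_def fun_eq_iff algebra_simps)

lemma shift_diff_geom_Suc:
  "shift_diff a (geom_seq l * Lambda_seq (Suc j))
     = seq_scale (l - a) (geom_seq l * Lambda_seq (Suc j)) + seq_scale l (geom_seq l * Lambda_seq j)"
  by (simp add: shift_diff_def geom_seq_def Lambda_seq_def seq_scale_def fun_eq_iff algebra_simps)

text \<open>\<open>E - a\<close> maps \<open>delta_seq (Suc i)\<close> to \<open>delta_seq i\<close>
  minus \<open>a\<close> times itself. For \<open>a = 0\<close> this gives a preimage at once;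
  otherwise the system is triangular with non-zero diagonal entry \<open>-a\<close> and is solved by
  recursion on \<open>i\<close>.\<close>

lemma shift_diff_onto_delta: "\<exists>g\<in>P_span. shift_diff a g = delta_seq i"
proof (cases "a = 0")
  case True
  then show ?thesis
    by (intro bexI[OF _ P_span_delta[of "Suc i"]])
       (unfold shift_diff_delta_Suc, simp add: seq_scale_def fun_eq_iff field_simps)
next
  case False
  show ?thesis
  proof (induction i)
    case 0
    show ?case
      using False
      by (intro bexI[OF _ P_span_scale[OF P_span_delta[of 0], of "- inverse a"]])
         (unfold shift_diff_scale shift_diff_delta_0, simp add: seq_scale_def fun_eq_iff field_simps)
  next
    case (Suc i)
    then obtain g where g: "g \<in> P_span" "shift_diff a g = delta_seq i" by blast
    show ?case
      using False
      by (intro bexI[OF _ P_span_scale[OF P_span_add[OF g(1)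
              P_span_scale[OF P_span_delta[of "Suc i"], of "- 1"]], of "inverse a"]])
         (unfold shift_diff_scale shift_diff_add shift_diff_delta_Suc g(2), simp add: seq_scale_def fun_eq_iff field_simps)
  qed
qed

text \<open>Here the diagonal entry is \<open>l - a\<close>. In the resonant case
  \<open>l = a\<close> it vanishes and the preimage has order \<open>Suc j\<close>, scaled by
  \<open>inverse l\<close>; otherwise recursion on \<open>j\<close> solves the triangular
  system.\<close>

lemma shift_diff_onto_geom:
  assumes "l \<noteq> 0"
  shows "\<exists>g\<in>P_span. shift_diff a g = geom_seq l * Lambda_seq j"
proof (cases "l = a")
  case True
  then show ?thesis
    using assms
    by (intro bexI[OF _ P_span_scale[OF P_span_geom[OF assms, of "Suc j"], of "inverse l"]])
       (unfold shift_diff_scale shift_diff_geom_Suc, simp add: seq_scale_def fun_eq_iff field_simps)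
next
  case False
  show ?thesis
  proof (induction j)
    case 0
    show ?case
      using False assms
      by (intro bexI[OF _ P_span_scale[OF P_span_geom[OF assms, of 0], of "inverse (l - a)"]])
         (unfold shift_diff_scale shift_diff_geom_0, simp add: seq_scale_def fun_eq_iff field_simps)
  next
    case (Suc j)
    then obtain g where g: "g \<in> P_span" "shift_diff a g = geom_seq l * Lambda_seq j" by blast
    show ?case
      using False assms
      by (intro bexI[OF _ P_span_scale[OF P_span_add[OF P_span_geom[OF assms, of "Suc j"]
              P_span_scale[OF g(1), of "- l"]], of "inverse (l - a)"]])
         (unfold shift_diff_scale shift_diff_add shift_diff_geom_Suc g(2), simp add: seq_scale_def fun_eq_iff field_simps)
  qed
qed

lemma shift_diff_onto:
  assumes "t \<in> P_span"
  shows "\<exists>g\<in>P_span. shift_diff a g = t"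
  using assms[unfolded P_span_def]
proof (induction rule: seq_space.span_induct_alt)
  case base
  show ?case
    by (rule bexI[of _ 0]) (simp_all add: shift_diff_def fun_eq_iff P_span_def seq_space.span_zero)
next
  case (step c x y)
  then obtain g where g: "g \<in> P_span" "shift_diff a g = y" by blast
  have "\<exists>h\<in>P_span. shift_diff a h = x"
    using step(1) by (auto simp: shift_diff_onto_delta) (use shift_diff_onto_geom in blast)
  then obtain h where h: "h \<in> P_span" "shift_diff a h = x" by blast
  show ?case
    by (rule bexI[OF _ P_span_add[OF P_span_scale[OF h(1), of c] g(1)]])
       (unfold shift_diff_add shift_diff_scale g h, rule refl)
qed

text \<open>The kernel of \<open>E - a\<close> consists of the multiples of \<open>a ^ k\<close>,
  which for \<open>a = 0\<close> is \<open>delta_seq 0\<close>.\<close>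

lemma shift_diff_eq_0_in_P_span:
  assumes "shift_diff a s = (\<lambda>_. 0)"
  shows "s \<in> P_span"
proof -
  have "s (Suc k) = a * s k" for k
    using assms by (simp add: shift_diff_def fun_eq_iff)
  then have s: "s k = a ^ k * s 0" for k by (induction k) simp_all
  show ?thesis
  proof (cases "a = 0")
    case True
    have "seq_scale (s 0) (delta_seq 0) = s"
      by (rule ext, subst (2) s) (simp add: True seq_scale_def delta_seq_def power_0_left)
    then show ?thesis using P_span_scale[OF P_span_delta, of "s 0" 0] by simp
  next
    case False
    have "seq_scale (s 0) (geom_seq a * Lambda_seq 0) = s"
      by (rule ext, subst (2) s) (simp add: seq_scale_def geom_seq_def Lambda_seq_def)
    then show ?thesis using P_span_scale[OF P_span_geom[OF False], of "s 0" 0] by simp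
  qed
qed

text \<open>Subtracting a preimage \<open>g\<close> supplied by \<open>shift_diff_onto\<close>
  leaves an element of the kernel, which lies in \<open>P_span\<close> as well.\<close>

lemma P_span_if_shift_diff:
  assumes "shift_diff a s \<in> P_span"
  shows "s \<in> P_span"
proof -
  obtain g where g: "g \<in> P_span" "shift_diff a g = shift_diff a s"
    using shift_diff_onto[OF assms] by blast
  have "shift_diff a (s + seq_scale (- 1) g) = (\<lambda>_. 0)"
    unfolding shift_diff_add shift_diff_scale g(2) by (simp add: seq_scale_def fun_eq_iff)
  then have "s + seq_scale (- 1) g + g \<in> P_span"
    by (intro P_span_add g(1) shift_diff_eq_0_in_P_span)
  moreover have "s + seq_scale (- 1) g + g = s" by (simp add: seq_scale_def fun_eq_iff)
  ultimately show ?thesis by simp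
qed

text \<open>One linear factor is removed at a time by \<open>P_span_if_shift_diff\<close>; since
  polynomials commute, the factor at the head of the list may act first.\<close>

lemma P_span_if_annihilated:
  assumes "\<And>k. shift_act (\<Prod>a\<leftarrow>as. [:- a, 1:]) s k = 0"
  shows "s \<in> P_span"
  using assms
proof (induction as arbitrary: s)
  case Nil
  then have "s = 0" by (auto simp: one_pCons shift_act_pCons fun_eq_iff)
  then show ?case unfolding P_span_def by (simp only: seq_space.span_zero)
next
  case (Cons a as)
  have "shift_act [:- a, 1:] s = shift_diff a s"
    by (simp add: shift_act_pCons shift_diff_def fun_eq_iff)
  then have "shift_act (\<Prod>a\<leftarrow>as. [:- a, 1:]) (shift_diff a s) k = 0" for k
    using Cons.prems[of k] shift_act_mult[of "\<Prod>a\<leftarrow>as. [:- a, 1:]" "[:- a, 1:]" s k]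
    by (simp add: mult.commute del: mult_pCons_left mult_pCons_right)
  then show ?case using Cons.IH P_span_if_shift_diff by blast
qed

section \<open>From the span to explicit coefficients\<close>

text \<open>A single bound \<open>N\<close> serves both sums, and every \<open>w j\<close> lies in
  \<open>geom_span\<close>, so that padding with zero terms is immediate.\<close>

definition has_P_form :: "nat \<Rightarrow> (nat \<Rightarrow> 'a::field) \<Rightarrow> bool" where
  "has_P_form N s \<longleftrightarrow> (\<exists>v w. (\<forall>j. w j \<in> geom_span) \<and>
     s = (\<lambda>k. (\<Sum>i\<le>N. v i * delta_seq i k) + (\<Sum>j\<le>N. w j k * Lambda_seq j k)))"

lemma geom_span_0: "0 \<in> geom_span"
  unfolding geom_span_def by (rule seq_space.span_zero)

lemma has_P_form_mono:
  assumes "has_P_form N s" "N \<le> M"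
  shows "has_P_form M s"
proof -
  obtain v w where w: "\<And>j. w j \<in> geom_span" and
    s: "s = (\<lambda>k. (\<Sum>i\<le>N. v i * delta_seq i k) + (\<Sum>j\<le>N. w j k * Lambda_seq j k))"
    using assms(1) unfolding has_P_form_def by blast
  have "(\<Sum>i\<le>N. v i * delta_seq i k) = (\<Sum>i\<le>M. (if i \<le> N then v i else 0) * delta_seq i k)"
    "(\<Sum>j\<le>N. w j k * Lambda_seq j k) = (\<Sum>j\<le>M. (if j \<le> N then w j else 0) k * Lambda_seq j k)" for k
    using assms(2) by (auto intro!: sum.mono_neutral_cong_left split: if_splits)
  then show ?thesis
    unfolding has_P_form_def s
    by (intro exI[of _ "\<lambda>i. if i \<le> N then v i else 0"] exI[of _ "\<lambda>j. if j \<le> N then w j else 0"])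
       (auto simp: w geom_span_0)
qed

lemma has_P_form_scale_add:
  assumes "has_P_form N s" "has_P_form N t"
  shows "has_P_form N (seq_scale c s + t)"
proof -
  obtain v w where w: "\<And>j. w j \<in> geom_span" and
    s: "s = (\<lambda>k. (\<Sum>i\<le>N. v i * delta_seq i k) + (\<Sum>j\<le>N. w j k * Lambda_seq j k))"
    using assms(1) unfolding has_P_form_def by blast
  obtain v' w' where w': "\<And>j. w' j \<in> geom_span" and
    t: "t = (\<lambda>k. (\<Sum>i\<le>N. v' i * delta_seq i k) + (\<Sum>j\<le>N. w' j k * Lambda_seq j k))"
    using assms(2) unfolding has_P_form_def by blast
  have "seq_scale c (w j) + w' j \<in> geom_span" for j
    using w w' unfolding geom_span_def by (intro seq_space.span_add seq_space.span_scale)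
  moreover have "seq_scale c s + t = (\<lambda>k. (\<Sum>i\<le>N. (c * v i + v' i) * delta_seq i k) +
      (\<Sum>j\<le>N. (seq_scale c (w j) + w' j) k * Lambda_seq j k))"
    by (simp add: s t seq_scale_def fun_eq_iff distrib_left distrib_right sum.distrib
        sum_distrib_left mult.assoc)
  ultimately show ?thesis unfolding has_P_form_def by fast
qed

lemma has_P_form_delta: "has_P_form i (delta_seq i)"
  unfolding has_P_form_def
  by (rule exI[of _ "\<lambda>j. if j = i then 1 else 0"], rule exI[of _ "\<lambda>_. 0"])
     (simp add: geom_span_0 fun_eq_iff if_distrib[of "\<lambda>x. x * _"] cong: if_cong)

lemma has_P_form_geom:
  assumes "l \<noteq> 0"
  shows "has_P_form j (geom_seq l * Lambda_seq j)"
proof -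
  have "geom_seq l \<in> geom_span"
    using assms unfolding geom_span_def by (intro seq_space.span_base) simp
  then show ?thesis
    unfolding has_P_form_def
    by (intro exI[of _ "\<lambda>_. 0"] exI[of _ "\<lambda>i. if i = j then geom_seq l else 0"])
       (simp add: geom_span_0 fun_eq_iff if_distrib[of "\<lambda>x. x _ * _"] cong: if_cong)
qed

lemma has_P_form_if_P_span:
  assumes "s \<in> P_span"
  shows "\<exists>N. has_P_form N s"
  using assms[unfolded P_span_def]
proof (induction rule: seq_space.span_induct_alt)
  case base
  have "has_P_form 0 (0 :: nat \<Rightarrow> 'a)"
    unfolding has_P_form_def
    by (rule exI[of _ "\<lambda>_. 0"], rule exI[of _ "\<lambda>_. 0"]) (simp add: geom_span_0 fun_eq_iff)
  then show ?case ..
next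
  case (step c x y)
  then obtain N where N: "has_P_form N y" by blast
  obtain i where i: "has_P_form i x" using step(1) has_P_form_delta has_P_form_geom by auto
  have "has_P_form (max i N) (seq_scale c x + y)"
    by (intro has_P_form_scale_add has_P_form_mono[OF N] has_P_form_mono[OF i]) auto
  then show ?case ..
qed

lemma P_canonical_form_exists:
  fixes U :: "nat \<Rightarrow> 'a::field mat"
  assumes U: "\<And>k. U k \<in> carrier_mat q q"
    and P: "\<And>r c. r < q \<Longrightarrow> c < q \<Longrightarrow> (\<lambda>k. U k $$ (r, c)) \<in> P_span"
  shows "\<exists>n V m W. is_P_canonical_form q U n V m W"
proof -
  let ?s = "\<lambda>(r, c) k. U k $$ (r, c)"
  \<comment> \<open>A property that holds for all large \<open>N\<close> can be required of the
    finitely many entries at once, which gives them a common bound.\<close>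
  have "eventually (\<lambda>N. has_P_form N (?s x)) sequentially" if x: "x \<in> {..<q} \<times> {..<q}" for x
  proof -
    have "?s x \<in> P_span" using x P by auto
    then obtain N where "has_P_form N (?s x)" using has_P_form_if_P_span by blast
    then show ?thesis using has_P_form_mono eventually_ge_at_top by (metis eventually_sequentially)
  qed
  then have "eventually (\<lambda>N. \<forall>x\<in>{..<q} \<times> {..<q}. has_P_form N (?s x)) sequentially"
    by (intro eventually_ball_finite) blast+
  then obtain N where "\<forall>x\<in>{..<q} \<times> {..<q}. has_P_form N (?s x)"
    unfolding eventually_sequentially by blast
  \<comment> \<open>Pairing the two coefficient families lets a single use of \<open>bchoice\<close>
    select both for every entry.\<close>
  then have "\<forall>x\<in>{..<q} \<times> {..<q}. \<exists>vw. (\<forall>j. snd vw j \<in> geom_span) \<and>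
      ?s x = (\<lambda>k. (\<Sum>i\<le>N. fst vw i * delta_seq i k) + (\<Sum>j\<le>N. snd vw j k * Lambda_seq j k))"
    unfolding has_P_form_def by fastforce
  then obtain f where f: "\<forall>x\<in>{..<q} \<times> {..<q}. (\<forall>j. snd (f x) j \<in> geom_span) \<and>
      ?s x = (\<lambda>k. (\<Sum>i\<le>N. fst (f x) i * delta_seq i k) + (\<Sum>j\<le>N. snd (f x) j k * Lambda_seq j k))"
    by (rule bchoice[THEN exE])
  define v w where "v = (\<lambda>x. fst (f x))" and "w = (\<lambda>x. snd (f x))"
  have w: "w x j \<in> geom_span" and
    s: "?s x = (\<lambda>k. (\<Sum>i\<le>N. v x i * delta_seq i k) + (\<Sum>j\<le>N. w x j k * Lambda_seq j k))"
    if "x \<in> {..<q} \<times> {..<q}" for x j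
    using f that unfolding v_def w_def by blast+
  define V where "V = (\<lambda>i. mat q q (\<lambda>x. v x i))"
  define W where "W = (\<lambda>j. mat q q (\<lambda>x. w x j))"
  have "U = P_sum q Lambda_seq N V N W"
  proof
    fix k
    show "U k = P_sum q Lambda_seq N V N W k"
    proof (rule eq_matI)
      fix r c assume "r < dim_row (P_sum q Lambda_seq N V N W k)" "c < dim_col (P_sum q Lambda_seq N V N W k)"
      then have "r < q" "c < q" by (simp_all add: P_sum_def)
      then show "U k $$ (r, c) = P_sum q Lambda_seq N V N W k $$ (r, c)"
        using s[of "(r, c)"] by (simp add: P_sum_def V_def W_def fun_eq_iff)
    qed (use U[of k] in \<open>simp_all add: P_sum_def\<close>)
  qed
  moreover have "elements_mat (W j) \<subseteq> geom_span" for j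
    by (auto simp: W_def elements_mat_def intro!: w)
  ultimately have "is_P_canonical_form q U N V N W"
    unfolding is_P_canonical_form_def by (simp add: V_def W_def)
  then show ?thesis by blast
qed

subsection \<open>Powers of a matrix\<close>

lemma pow_mat_add:
  assumes A: "(A :: 'a::semiring_1 mat) \<in> carrier_mat q q"
  shows "A ^\<^sub>m k * A ^\<^sub>m l = A ^\<^sub>m (k + l)"
proof (induction l)
  case (Suc l)
  have "A ^\<^sub>m k * (A ^\<^sub>m l * A) = A ^\<^sub>m k * A ^\<^sub>m l * A"
    by (rule assoc_mult_mat[symmetric]) (use A in auto)
  then show ?case using Suc by simp
qed (use A in simp)

section \<open>The ring of matrix sequences\<close>

lemma ring_mat_seq_ring: "ring (mat_seq_ring q :: (nat \<Rightarrow> 'a::field mat) ring)"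
proof (rule ringI)
  show "abelian_group (mat_seq_ring q :: (nat \<Rightarrow> 'a mat) ring)" (is "abelian_group ?R")
  proof (rule abelian_groupI)
    fix U V assume "U \<in> carrier ?R" "V \<in> carrier ?R"
    then have "U k + V k = V k + U k" for k
      by (intro comm_add_mat[of _ q q]) (auto simp: mat_seq_ring_def)
    then show "U \<oplus>\<^bsub>?R\<^esub> V = V \<oplus>\<^bsub>?R\<^esub> U" by (simp add: mat_seq_ring_def)
  next
    fix U assume "U \<in> carrier ?R"
    then show "\<exists>V\<in>carrier ?R. V \<oplus>\<^bsub>?R\<^esub> U = \<zero>\<^bsub>?R\<^esub>"
      by (intro bexI[of _ "\<lambda>k. - U k"]) (auto simp: mat_seq_ring_def uminus_l_inv_mat)
  qed (auto simp: mat_seq_ring_def assoc_add_mat[of _ q q])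
  show "Group.monoid (mat_seq_ring q :: (nat \<Rightarrow> 'a mat) ring)"
    by (intro monoidI) (auto simp: mat_seq_ring_def fun_eq_iff assoc_mult_mat[of _ q q _ q _ q]
        mult_carrier_mat[of _ q q] left_mult_one_mat[of _ q q] right_mult_one_mat[of _ q q])
qed (auto simp: mat_seq_ring_def fun_eq_iff add_mult_distrib_mat[of _ q q _ _ q]
    mult_add_distrib_mat[of _ q q _ q])

lemma mat_seq_ring_minus:
  assumes "\<And>k. U k \<in> carrier_mat q q" "\<And>k. V k \<in> carrier_mat q q"
  shows "U \<ominus>\<^bsub>mat_seq_ring q\<^esub> V = (\<lambda>k. U k - V k)"
proof -
  interpret ring "mat_seq_ring q :: (nat \<Rightarrow> 'a mat) ring" by (rule ring_mat_seq_ring)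
  have "\<ominus>\<^bsub>mat_seq_ring q\<^esub> V = (\<lambda>k. - V k)"
    using assms by (intro minus_equality) (auto simp: mat_seq_ring_def fun_eq_iff uminus_l_inv_mat)
  then show ?thesis
    using assms by (simp add: minus_eq) (simp add: mat_seq_ring_def fun_eq_iff minus_add_uminus_mat[of _ q q])
qed

lemma mat_seq_ring_pow:
  assumes "A \<in> carrier_mat q q"
  shows "(\<lambda>k. A ^\<^sub>m k) [^]\<^bsub>mat_seq_ring q\<^esub> (N::nat) = (\<lambda>k. A ^\<^sub>m (k * N))"
proof -
  interpret ring "mat_seq_ring q :: (nat \<Rightarrow> 'a mat) ring" by (rule ring_mat_seq_ring)
  show ?thesis
  proof (induction N)
    case (Suc N)
    then show ?case
      using pow_mat_add[OF assms] by (simp add: mat_seq_ring_def fun_eq_iff add.commute)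
  qed (use assms in \<open>simp add: mat_seq_ring_def\<close>)
qed

section \<open>Two-sided recurrent matrix sequences\<close>

definition birec_mat :: "nat \<Rightarrow> (int \<Rightarrow> 'a::field mat) \<Rightarrow> bool" where
  "birec_mat q F \<longleftrightarrow> (\<forall>l. F l \<in> carrier_mat q q) \<and> (\<forall>r<q. \<forall>c<q. (\<lambda>l. F l $$ (r, c)) \<in> birec)"

text \<open>Entries of the product are fixed linear combinations of entries of \<open>F l\<close>.
  Only one factor varies, so products \<open>Q k * Q l\<close> are later treated with one index held
  fixed.\<close>

lemma birec_mat_mult:
  assumes F: "birec_mat q F" and B: "B \<in> carrier_mat q q"
  shows "birec_mat q (\<lambda>l. B * F l)" "birec_mat q (\<lambda>l. F l * B)"
proof -
  have Fc: "F l \<in> carrier_mat q q" for l using F by (simp add: birec_mat_def)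
  have "(\<lambda>l. \<Sum>k<q. B $$ (r, k) * F l $$ (k, c)) \<in> birec"
    "(\<lambda>l. \<Sum>k<q. B $$ (k, c) * F l $$ (r, k)) \<in> birec" if "r < q" "c < q" for r c
    using F that by (auto simp: birec_mat_def intro!: birec_sum birec_scale)
  then show "birec_mat q (\<lambda>l. B * F l)" "birec_mat q (\<lambda>l. F l * B)"
    unfolding birec_mat_def
    using index_mat_mult_sum[OF B Fc] index_mat_mult_sum[OF Fc B] mult_carrier_mat[OF B Fc]
      mult_carrier_mat[OF Fc B]
    by (simp_all add: mult.commute del: index_mult_mat)
qed

lemma birec_mat_shift: "birec_mat q F \<Longrightarrow> birec_mat q (\<lambda>l. F (m + l))"
  unfolding birec_mat_def by (auto intro: birec_shift[of "\<lambda>l. F l $$ _"])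

lemma birec_mat_eqI:
  assumes F: "birec_mat q F" and G: "birec_mat q G" and eq: "\<And>l. l \<ge> K \<Longrightarrow> F l = G l"
  shows "F l = G l"
proof (rule eq_matI)
  fix r c assume "r < dim_row (G l)" "c < dim_col (G l)"
  then have "r < q" "c < q" using G carrier_matD[of "G l" q q] by (auto simp: birec_mat_def)
  then show "F l $$ (r, c) = G l $$ (r, c)"
    by - (rule birec_eqI[of "\<lambda>l. F l $$ (r, c)" "\<lambda>l. G l $$ (r, c)" K],
        use F G eq in \<open>auto simp: birec_mat_def\<close>)
qed (use F G carrier_matD[of "F l" q q] carrier_matD[of "G l" q q] in \<open>auto simp: birec_mat_def\<close>)

text \<open>Stated for an arbitrary canonical form, so that it yields both the complete inverse and
  the fact that all forms give the same value of \<open>theta1\<close>.\<close>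

lemma complete_inverse_of_P_canonical_form:
  fixes A :: "'a::field mat"
  assumes A: "A \<in> carrier_mat q q"
    and form: "is_P_canonical_form q (\<lambda>k. A ^\<^sub>m k) n V m W"
  shows "is_complete_inverse (mat_seq_ring q) (\<lambda>k. A ^\<^sub>m k)
           (P_sum q Lambda_neg_seq n V m (\<lambda>j. map_mat theta (W j)))"
proof -
  \<comment> \<open>The terms \<open>W j\<close> of the form, extended to all integers.\<close>
  define Q where "Q = (\<lambda>l. mat q q (\<lambda>(r, c). \<Sum>j\<le>m. geom_ext (W j $$ (r, c)) l * bi_choose j l))"
  have Wc: "W j \<in> carrier_mat q q" if "j \<le> m" for j
    using form that by (simp add: is_P_canonical_form_def)
  have W: "W j $$ (r, c) \<in> geom_span" if "j \<le> m" "r < q" "c < q" for j r c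
  proof -
    have "W j $$ (r, c) \<in> elements_mat (W j)" using Wc that by (intro elements_matI) auto
    then show ?thesis using form that by (auto simp: is_P_canonical_form_def)
  qed
  have Q: "birec_mat q Q"
    unfolding birec_mat_def Q_def
    by (auto intro!: birec_sum bigeom_bi_choose_birec geom_ext W)
  then have Qc [simp]: "Q l \<in> carrier_mat q q" for l by (simp add: birec_mat_def)
  have Qd [simp]: "dim_row (Q l) = q" "dim_col (Q l) = q" for l
    using carrier_matD[OF Qc[of l]] by simp_all
  have theta_W: "map_mat theta (W j) $$ (r, c) = theta (W j $$ (r, c))"
    if "j \<le> m" "r < q" "c < q" for j r c
    using Wc[OF that(1)] that by simp
  have Ac [simp]: "A ^\<^sub>m k \<in> carrier_mat q q" for k using A by simp
  have pow: "A ^\<^sub>m k = P_sum q Lambda_seq n V m W k" for k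
    using form by (simp add: is_P_canonical_form_def fun_eq_iff)
  \<comment> \<open>Beyond \<open>n\<close> every delta term vanishes.\<close>
  have AQ: "A ^\<^sub>m k = Q (int k)" if "k > n" for k
    unfolding pow P_sum_def Q_def using that
    by (intro cong_mat) (auto simp: delta_seq_def geom_ext W intro!: sum.neutral)
  have AQ': "A ^\<^sub>m nat l = Q l" if "l \<ge> int n + 1" for l
    using AQ[of "nat l"] that by simp
  \<comment> \<open>The bracket is the sum of the delta terms, which are kept; the remaining terms
    are reflected to \<open>Q (- int k)\<close>.\<close>
  have X: "P_sum q Lambda_neg_seq n V m (\<lambda>j. map_mat theta (W j)) k
      = Q (- int k) + (A ^\<^sub>m k - Q (int k))" for k
    unfolding pow P_sum_def Q_def
    by (rule eq_matI) (use Wc in \<open>auto simp: theta_W theta_apply geom_ext W\<close>)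
  have AkQ: "A ^\<^sub>m k * Q l = Q (int k + l)" "Q l * A ^\<^sub>m k = Q (int k + l)" for k l
  proof -
    \<comment> \<open>For such \<open>l\<close> both values of \<open>Q\<close> are powers of
      \<open>A\<close>; the identities then extend to all \<open>l\<close> by recurrence.\<close>
    have *: "A ^\<^sub>m k * Q l = Q (int k + l)" "Q l * A ^\<^sub>m k = Q (int k + l)" if "l \<ge> int n + 1" for l
    proof -
      have l: "Q l = A ^\<^sub>m nat l" "Q (int k + l) = A ^\<^sub>m (k + nat l)"
        using that AQ'[of l] AQ'[of "int k + l"] by (simp_all add: nat_add_distrib)
      show "A ^\<^sub>m k * Q l = Q (int k + l)" "Q l * A ^\<^sub>m k = Q (int k + l)"
        unfolding l pow_mat_add[OF A] by (simp_all add: add.commute)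
    qed
    show "A ^\<^sub>m k * Q l = Q (int k + l)"
      by (rule birec_mat_eqI[OF birec_mat_mult(1)[OF Q Ac] birec_mat_shift[OF Q] *(1)])
    show "Q l * A ^\<^sub>m k = Q (int k + l)"
      by (rule birec_mat_eqI[OF birec_mat_mult(2)[OF Q Ac] birec_mat_shift[OF Q] *(2)])
  qed
  have QQ: "Q k * Q l = Q (k + l)" for k l
  proof -
    have "Q k * Q l = Q (l + k)"
    \<comment> \<open>Now \<open>l\<close> is fixed and the first index varies; for large values the
      first factor is a power of \<open>A\<close> and \<open>AkQ\<close> applies.\<close>
    proof (rule birec_mat_eqI[OF birec_mat_mult(2)[OF Q Qc] birec_mat_shift[OF Q]])
      fix k assume "k \<ge> int n + 1"
      then show "Q k * Q l = Q (l + k)"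
        using AkQ(1)[of "nat k" l] AQ'[of k] by (simp add: add.commute split: if_splits)
    qed
    then show ?thesis by (simp add: add.commute)
  qed
  \<comment> \<open>At \<open>k = 0\<close> the entry of the sequence is the identity, which is its
    own Drazin inverse, whereas \<open>Q 0\<close> is in general only an idempotent.\<close>
  define d where "d = (\<lambda>k. if k = 0 then 1\<^sub>m q else Q (- int k))"
  have dc [simp]: "d k \<in> carrier_mat q q" for k by (simp add: d_def)
  have A0: "A ^\<^sub>m 0 = 1\<^sub>m q" using A by simp
  let ?R = "mat_seq_ring q :: (nat \<Rightarrow> 'a mat) ring"
  let ?a = "\<lambda>k. A ^\<^sub>m k"
  interpret ring ?R by (rule ring_mat_seq_ring)
  have mult: "mult ?R = (\<lambda>U V k. U k * V k)" and add: "add ?R = (\<lambda>U V k. U k + V k)"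
    and carr: "U \<in> carrier ?R \<longleftrightarrow> (\<forall>k. U k \<in> carrier_mat q q)" for U
    by (simp_all add: mat_seq_ring_def)
  have ad: "A ^\<^sub>m k * d k = (if k = 0 then 1\<^sub>m q else Q 0)" for k
    using A0 by (simp add: d_def AkQ del: pow_mat.simps)
  have da: "d k * A ^\<^sub>m k = (if k = 0 then 1\<^sub>m q else Q 0)" for k
    using A0 by (simp add: d_def AkQ del: pow_mat.simps)
  have inverse: "is_complete_inverse ?R ?a (d \<oplus>\<^bsub>?R\<^esub> (?a \<ominus>\<^bsub>?R\<^esub> ?a \<otimes>\<^bsub>?R\<^esub> d \<otimes>\<^bsub>?R\<^esub> ?a))"
  proof (rule complete_inverse_of_Drazin[where n = "Suc n"])
    show "d \<otimes>\<^bsub>?R\<^esub> ?a \<otimes>\<^bsub>?R\<^esub> d = d"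
      by (simp add: mult da) (simp add: d_def QQ fun_eq_iff)
    \<comment> \<open>One exponent has to serve every \<open>k\<close>: for \<open>k > 0\<close> the
      number \<open>k * Suc n\<close> exceeds \<open>n\<close>, so the power is a value of
      \<open>Q\<close>; at \<open>k = 0\<close> all factors are the identity.\<close>
    show "?a [^]\<^bsub>?R\<^esub> Suc n \<otimes>\<^bsub>?R\<^esub> ?a \<otimes>\<^bsub>?R\<^esub> d = ?a [^]\<^bsub>?R\<^esub> Suc n"
      unfolding mat_seq_ring_pow[OF A] mult
    proof
      fix k
      have "A ^\<^sub>m (k * Suc n) * A ^\<^sub>m k * d k = A ^\<^sub>m (k * Suc n) * (A ^\<^sub>m k * d k)"
        by (rule assoc_mult_mat[OF Ac Ac dc])
      also have "\<dots> = A ^\<^sub>m (k * Suc n)"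
      proof (cases "k = 0")
        case False
        then have "k * Suc n > n" by (cases k) auto
        then show ?thesis using False by (simp add: ad AkQ AQ QQ del: mult_Suc_right)
      qed (use A0 in \<open>simp add: d_def del: pow_mat.simps\<close>)
      finally show "A ^\<^sub>m (k * Suc n) * A ^\<^sub>m k * d k = A ^\<^sub>m (k * Suc n)" .
    qed
  qed (simp_all add: carr mult ad da del: pow_mat.simps)
  have eq: "d \<oplus>\<^bsub>?R\<^esub> (?a \<ominus>\<^bsub>?R\<^esub> ?a \<otimes>\<^bsub>?R\<^esub> d \<otimes>\<^bsub>?R\<^esub> ?a)
      = P_sum q Lambda_neg_seq n V m (\<lambda>j. map_mat theta (W j))"
  proof -
    have ada: "A ^\<^sub>m k * d k * A ^\<^sub>m k = (if k = 0 then 1\<^sub>m q else Q (int k))" for k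
      using A0 by (simp add: ad AkQ del: pow_mat.simps)
    \<comment> \<open>At \<open>k = 0\<close> the summands on the two sides may differ, but both
      sides add up to the identity.\<close>
    have ptwise: "d k + (A ^\<^sub>m k - A ^\<^sub>m k * d k * A ^\<^sub>m k) = Q (- int k) + (A ^\<^sub>m k - Q (int k))" for k
    proof (cases "k = 0")
      case True
      have "1\<^sub>m q + (1\<^sub>m q - 1\<^sub>m q) = Q 0 + (1\<^sub>m q - Q 0)"
        by (rule eq_matI) auto
      then show ?thesis using A0 True ada[of 0] by (simp add: d_def del: pow_mat.simps)
    next
      case False
      then have "A ^\<^sub>m k * d k * A ^\<^sub>m k = Q (int k)" by (simp only: ada if_False)
      then show ?thesis using False by (simp only: d_def if_False)
    qed
    have "(\<lambda>k. d k + (A ^\<^sub>m k - A ^\<^sub>m k * d k * A ^\<^sub>m k))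
        = P_sum q Lambda_neg_seq n V m (\<lambda>j. map_mat theta (W j))"
      by (rule ext) (unfold X, rule ptwise)
    moreover have "?a \<ominus>\<^bsub>?R\<^esub> (\<lambda>k. A ^\<^sub>m k * d k * A ^\<^sub>m k) = (\<lambda>k. A ^\<^sub>m k - A ^\<^sub>m k * d k * A ^\<^sub>m k)"
      by (rule mat_seq_ring_minus[OF Ac mult_carrier_mat[OF mult_carrier_mat[OF Ac dc] Ac]])
    ultimately show ?thesis
      by (simp only: mult add)
  qed
  show ?thesis using inverse unfolding eq .
qed

theorem theorem3p3:
  fixes A :: "'a::field mat" and q t0 :: nat
  assumes "A \<in> carrier_mat q q"
    and "mat_index q A = t0"
    and "\<exists>as. char_poly A = (\<Prod>a\<leftarrow>as. [:- a, 1:])"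
  shows "is_complete_inverse (mat_seq_ring q) (\<lambda>k. A ^\<^sub>m k) (theta1 q (\<lambda>k. A ^\<^sub>m k))"
proof -
  let ?a = "\<lambda>k. A ^\<^sub>m k"
  obtain as where as: "char_poly A = (\<Prod>a\<leftarrow>as. [:- a, 1:])" using assms(3) by blast
  have P: "(\<lambda>k. (A ^\<^sub>m k) $$ (r, c)) \<in> P_span" if "r < q" "c < q" for r c
    using shift_act_char_poly[OF assms(1) that] unfolding as by (rule P_span_if_annihilated)
  obtain n V m W where form: "is_P_canonical_form q ?a n V m W"
    using P_canonical_form_exists[OF pow_carrier_mat[OF assms(1)] P] by blast
  let ?X = "P_sum q Lambda_neg_seq n V m (\<lambda>j. map_mat theta (W j))"
  have X: "is_complete_inverse (mat_seq_ring q) ?a ?X"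
    by (rule complete_inverse_of_P_canonical_form[OF assms(1) form])
  have "theta1 q ?a = ?X"
    unfolding theta1_def
  proof (rule the_equality)
    show "\<exists>n' V' m' W'. is_P_canonical_form q ?a n' V' m' W' \<and>
        ?X = P_sum q Lambda_neg_seq n' V' m' (\<lambda>j. map_mat theta (W' j))"
      using form by blast
  next
    fix Y assume "\<exists>n' V' m' W'. is_P_canonical_form q ?a n' V' m' W' \<and>
        Y = P_sum q Lambda_neg_seq n' V' m' (\<lambda>j. map_mat theta (W' j))"
    \<comment> \<open>Two canonical forms are compared through their values: each yields a complete
      inverse of the same sequence, and that inverse is unique.\<close>
    then have "is_complete_inverse (mat_seq_ring q) ?a Y"
      using complete_inverse_of_P_canonical_form[OF assms(1)] by blast
    then show "Y = ?X" using X unfolding is_complete_inverse_def by blast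
  qed
  then show ?thesis using X by simp
qed

end
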